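(* Let $(\mathcal X,\mathcal A)$ be a measurable space, let $\mathcal P\subseteq\mathrm{Prob}(\mathcal X,\mathcal A)$ be a homogeneous model and let $I$ be a set. For each $i\in I$, let $\mathcal C_i$ be a sub-$\sigma$-algebra of $\mathcal A$ and let $(\mathcal P_{i,\eta}:\eta\in H_i)$ be an exhaustion of $\mathcal P$. Assume that the following property holds: if $P',P''\in\mathcal P$, then there exist $n\in\mathbb N$ and $P_1,\ldots,P_n\in\mathcal P$ with $P_1=P'$, $P_n=P''$, and such that for each $k\in\{1,\ldots,n-1\}$ there exist $i\in I$ and $\eta\in H_i$ with $P_k,P_{k+1}\in\mathcal P_{i,\eta}$. (a) If, for each $i\in I$, $\mathcal C_i$ is sufficient for each $\mathcal P_{i,\eta}$ ($\eta\in H_i$), then $\bigvee_{i\in I}\mathcal C_i$ is sufficient for $\mathcal P$. (b) If, for each $i\in I$, $\mathcal C_i$ is minimal sufficient for each $\mathcal P_{i,\eta}$ ($\eta\in H_i$), then $\bigvee_{i\in I}\mathcal C_i$ is minimal sufficient for $\mathcal P$. (c) If, for each $i\in I$, $\mathcal C_i$ is complete and sufficient for each $\mathcal P_{i,\eta}$ ($\eta\in H_i$), then $\bigvee_{i\in I}\mathcal C_i$ is complete and sufficient for $\mathcal P$.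
   Context: $\mathrm{Prob}(\mathcal X,\mathcal A)$ denotes the set of all probability measures (laws) on $(\mathcal X,\mathcal A)$. A model on $(\mathcal X,\mathcal A)$ is a subset $\mathcal P\subseteq\mathrm{Prob}(\mathcal X,\mathcal A)$; a submodel is a subset of $\mathcal P$. An exhaustion of $\mathcal P$ is a family $(\mathcal P_\eta:\eta\in H)$ of submodels of $\mathcal P$ with $\bigcup_{\eta\in H}\mathcal P_\eta=\mathcal P$. A model is homogeneous if its members are mutually absolutely continuous. A sub-$\sigma$-algebra $\mathcal C$ of $\mathcal A$ is sufficient for $\mathcal P$ if for every $A\in\mathcal A$ there is a $\mathcal C$-measurable function that is a version of the conditional probability $P(A\,|\,\mathcal C)$ simultaneously for all $P\in\mathcal P$. For sub-$\sigma$-algebras $\mathcal C,\mathcal D$ write $\mathcal C\subseteq\mathcal D$ $[\mathcal P]$ if for every $C\in\mathcal C$ there is a $D\in\mathcal D$ with $P(C\,\triangle\,D)=0$ for all $P\in\mathcal P$. $\mathcal C$ is minimal sufficient for $\mathcal P$ if it is sufficient for $\mathcal P$ and $\mathcal C\subseteq\mathcal D$ $[\mathcal P]$ for every $\mathcal D$ sufficient for $\mathcal P$. $\mathcal C$ is complete for $\mathcal P$ if every $\mathcal C$-measurable $h:\mathcal X\to\mathbb R$ that is integrable with respect to every $P\in\mathcal P$ and satisfies $\int h\,dP=0$ for all $P\in\mathcal P$ also satisfies $h=0$ $P$-a.s. for every $P\in\mathcal P$. $\bigvee_{i\in I}\mathcal C_i$ denotes the smallest sub-$\sigma$-algebra of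 $\mathcal A$ containing every $\mathcal C_i$. *)

theory Defs
  imports "HOL-Probability.Probability"
begin

text \<open>
  A measurable space is given by a measure \<open>M\<close> of which only \<open>space M\<close> and \<open>sets M\<close> matter.
  Likewise a sub-\<open>\<sigma>\<close>-algebra is given by a measure \<open>C\<close> with \<open>subalgebra M C\<close>, of which only
  \<open>space C = space M\<close> and \<open>sets C\<close> matter.
\<close>

text \<open>By \<open>space_prob_algebra\<close>, the elements of \<open>space (prob_algebra M)\<close> are exactly the
  probability measures on the \<open>\<sigma>\<close>-algebra of \<open>M\<close>.\<close>

definition model :: "'a measure \<Rightarrow> 'a measure set \<Rightarrow> bool" where
  "model M \<P> \<longleftrightarrow> \<P> \<subseteq> space (prob_algebra M)"

definition exhaustion :: "'a measure set \<Rightarrow> 'h set \<Rightarrow> ('h \<Rightarrow> 'a measure set) \<Rightarrow> bool" where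
  "exhaustion \<P> H \<Q> \<longleftrightarrow> (\<forall>\<eta>\<in>H. \<Q> \<eta> \<subseteq> \<P>) \<and> (\<Union>\<eta>\<in>H. \<Q> \<eta>) = \<P>"

definition homogeneous :: "'a measure set \<Rightarrow> bool" where
  "homogeneous \<P> \<longleftrightarrow> (\<forall>P\<in>\<P>. \<forall>Q\<in>\<P>. absolutely_continuous P Q)"

definition sufficient_for :: "'a measure \<Rightarrow> 'a measure set \<Rightarrow> 'a measure \<Rightarrow> bool" where
  "sufficient_for M \<P> C \<longleftrightarrow>
     subalgebra M C \<and>
     (\<forall>A\<in>sets M. \<exists>f\<in>borel_measurable C. \<forall>P\<in>\<P>. AE x in P. f x = real_cond_exp P C (indicator A) x)"

text \<open>\<open>\<C> \<subseteq> \<D> [\<P>]\<close>; \<open>sym_diff\<close> is the symmetric difference.\<close>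

definition subalg_mod :: "'a measure set \<Rightarrow> 'a measure \<Rightarrow> 'a measure \<Rightarrow> bool" where
  "subalg_mod \<P> C D \<longleftrightarrow> (\<forall>A\<in>sets C. \<exists>B\<in>sets D. \<forall>P\<in>\<P>. emeasure P (sym_diff A B) = 0)"

definition minimal_sufficient_for :: "'a measure \<Rightarrow> 'a measure set \<Rightarrow> 'a measure \<Rightarrow> bool" where
  "minimal_sufficient_for M \<P> C \<longleftrightarrow>
     sufficient_for M \<P> C \<and> (\<forall>D. sufficient_for M \<P> D \<longrightarrow> subalg_mod \<P> C D)"

definition complete_for :: "'a measure \<Rightarrow> 'a measure set \<Rightarrow> 'a measure \<Rightarrow> bool" where
  "complete_for M \<P> C \<longleftrightarrow>
     subalgebra M C \<and>
     (\<forall>h :: 'a \<Rightarrow> real. h \<in> borel_measurable C \<longrightarrow>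
        (\<forall>P\<in>\<P>. integrable P h \<and> (\<integral>x. h x \<partial>P) = 0) \<longrightarrow>
        (\<forall>P\<in>\<P>. AE x in P. h x = 0))"

definition subalg_join :: "'a measure \<Rightarrow> 'i set \<Rightarrow> ('i \<Rightarrow> 'a measure) \<Rightarrow> 'a measure" where
  "subalg_join M I C = sigma (space M) (\<Union>i\<in>I. sets (C i))"

end

theory Submission
  imports Defs
begin

text \<open>
  For homogeneous models sufficiency is a statement about densities. If \<open>P\<close> and \<open>Q\<close> are equivalent
  laws, then a \<open>\<sigma>\<close>-algebra is sufficient for \<open>{P, Q}\<close> exactly when it carries a version of the density
  of \<open>Q\<close> with respect to \<open>P\<close> (lemmas \<open>sufficient_imp_density_over\<close> and
  \<open>sufficient_if_density_over\<close>). In this form sufficiency propagates along chains: the density of the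
  last member of a chain with respect to the first is the product of the densities of consecutive
  members. Each factor is measurable with respect to some \<open>\<C>\<^sub>i\<close>, hence with respect to the join, and
  so is the product. This proves part (a).

  For part (b), a \<open>\<D>\<close> sufficient for \<open>\<P>\<close> is sufficient for every submodel, so it contains each
  \<open>\<C>\<^sub>i\<close> up to null sets of some law in \<open>\<P>\<close>. By homogeneity these are null sets of all laws in \<open>\<P>\<close>,
  and containment up to common null sets passes to the generated \<open>\<sigma>\<close>-algebra.

  Part (c) rests on an observation that can be iterated. Call a function an unbiased estimator of zero
  if its integral vanishes under every law in \<open>\<P>\<close>. Given such an \<open>h\<close>, completeness applied to the
  conditional expectation of \<open>h\<close> given \<open>\<C>\<^sub>i\<close>, which all laws of a submodel \<open>\<P>\<^sub>i\<^sub>,\<^sub>\<eta>\<close> have in common,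
  shows that this conditional expectation vanishes, so that \<open>h\<close> multiplied by the indicator of any
  member of \<open>\<C>\<^sub>i\<close> is again an unbiased estimator of zero. The sets whose indicators preserve unbiased
  estimators of zero form a \<open>\<sigma>\<close>-algebra, which therefore contains the join. If \<open>h\<close> is measurable with
  respect to the join, its integrals over all sets of the join vanish, and hence \<open>h\<close> vanishes.
\<close>

section \<open>Laws, submodels and joins\<close>

lemma modelD:
  assumes "model M \<P>" "P \<in> \<P>"
  shows "prob_space P" "sets P = sets M" "space P = space M"
proof -
  show "prob_space P" and s: "sets P = sets M"
    using assms by (auto simp: model_def space_prob_algebra)
  show "space P = space M" using s by (rule sets_eq_imp_space_eq)
qed

lemma model_subset: "model M \<P> \<Longrightarrow> \<Q> \<subseteq> \<P> \<Longrightarrow> model M \<Q>"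
  by (auto simp: model_def)

lemma homogeneous_subset: "homogeneous \<P> \<Longrightarrow> \<Q> \<subseteq> \<P> \<Longrightarrow> homogeneous \<Q>"
  by (auto simp: homogeneous_def)

lemma sufficient_for_subset:
  "sufficient_for M \<P> C \<Longrightarrow> \<Q> \<subseteq> \<P> \<Longrightarrow> sufficient_for M \<Q> C"
  unfolding sufficient_for_def by (meson subsetD)

lemma exhaustion_member:
  assumes "exhaustion \<P> H \<Q>" "P \<in> \<P>"
  obtains \<eta> where "\<eta> \<in> H" "P \<in> \<Q> \<eta>" "\<Q> \<eta> \<subseteq> \<P>"
  using assms unfolding exhaustion_def by auto

lemma finite_measure_subalgebra_law:
  assumes "prob_space P" "sets P = sets M" "subalgebra M C"
  shows "finite_measure_subalgebra P C"
proof -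
  interpret prob_space P by fact
  show ?thesis
    using assms sets_eq_imp_space_eq[OF assms(2)]
    by unfold_locales (simp add: subalgebra_def)
qed

lemma sets_subalg_join:
  assumes "\<And>i. i \<in> I \<Longrightarrow> subalgebra M (C i)"
  shows "sets (subalg_join M I C) = sigma_sets (space M) (\<Union>i\<in>I. sets (C i))"
proof -
  have "(\<Union>i\<in>I. sets (C i)) \<subseteq> Pow (space M)"
    using assms sets.sets_into_space by (fastforce simp: subalgebra_def)
  then show ?thesis by (simp add: subalg_join_def)
qed

lemma subalgebra_subalg_join:
  assumes "\<And>i. i \<in> I \<Longrightarrow> subalgebra M (C i)"
  shows "subalgebra M (subalg_join M I C)"
proof -
  have "(\<Union>i\<in>I. sets (C i)) \<subseteq> sets M"
    using assms by (auto simp: subalgebra_def)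
  then show ?thesis
    by (simp add: subalgebra_def sets_subalg_join[OF assms] sets.sigma_sets_subset)
       (simp add: subalg_join_def space_measure_of_conv)
qed

lemma subalgebra_in_subalg_join:
  assumes "\<And>i. i \<in> I \<Longrightarrow> subalgebra M (C i)" "i \<in> I"
  shows "subalgebra (subalg_join M I C) (C i)"
proof -
  have "sets (C i) \<subseteq> sets (subalg_join M I C)"
    using assms by (subst sets_subalg_join) auto
  moreover have "space (C i) = space (subalg_join M I C)"
    using assms by (simp add: subalgebra_def subalg_join_def space_measure_of_conv)
  ultimately show ?thesis by (simp add: subalgebra_def)
qed

section \<open>Sufficiency and measurable densities\<close>

text \<open>The density is required to be a real function that is measurable with respect to \<open>C\<close> itself,
  not merely almost everywhere equal to such a function. The law \<open>Q\<close> is then literally equal to a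
  density measure, and products of densities need no null sets.\<close>

definition density_over :: "'a measure \<Rightarrow> 'a measure \<Rightarrow> 'a measure \<Rightarrow> bool" where
  "density_over C P Q \<longleftrightarrow>
     (\<exists>g\<in>borel_measurable C. (\<forall>x. 0 \<le> (g x :: real)) \<and> Q = density P (\<lambda>x. ennreal (g x)))"

lemma density_over_refl: "density_over C P P"
  unfolding density_over_def by (rule bexI[of _ "\<lambda>_. 1"]) (auto simp: density_1)

lemma density_over_trans:
  assumes "subalgebra P C" "density_over C P Q" "density_over C Q R"
  shows "density_over C P R"
proof -
  obtain g where g: "g \<in> borel_measurable C" "\<And>x. 0 \<le> (g x :: real)"
    "Q = density P (\<lambda>x. ennreal (g x))"
    using assms(2) by (auto simp: density_over_def)
  obtain h where h: "h \<in> borel_measurable C" "\<And>x. 0 \<le> (h x :: real)"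
    "R = density Q (\<lambda>x. ennreal (h x))"
    using assms(3) by (auto simp: density_over_def)
  have [measurable]: "g \<in> borel_measurable P" "h \<in> borel_measurable P"
    using g(1) h(1) measurable_from_subalg[OF assms(1)] by auto
  have "R = density P (\<lambda>x. ennreal (g x) * ennreal (h x))"
    unfolding h(3) g(3) by (rule density_density_eq) auto
  also have "\<dots> = density P (\<lambda>x. ennreal (g x * h x))"
    using g(2) h(2) by (simp add: ennreal_mult)
  finally show ?thesis
    unfolding density_over_def using g h
    by (intro bexI[of _ "\<lambda>x. g x * h x"]) auto
qed

lemma density_over_mono:
  "subalgebra D C \<Longrightarrow> density_over C P Q \<Longrightarrow> density_over D P Q"
  unfolding density_over_def by (meson measurable_from_subalg)

text \<open>The density of the restrictions to \<open>C\<close> is already a density on the whole \<open>\<sigma>\<close>-algebra: to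
  integrate the indicator of a set under \<open>Q\<close>, replace it by the conditional probability common to \<open>P\<close>
  and \<open>Q\<close>, which lives on \<open>C\<close>; change the measure there; and undo the replacement under \<open>P\<close>.\<close>

lemma sufficient_imp_density_over:
  assumes P: "prob_space P" "sets P = sets M"
    and Q: "prob_space Q" "sets Q = sets M"
    and ac: "absolutely_continuous P Q"
    and suff: "sufficient_for M {P, Q} C"
  shows "density_over C P Q"
proof -
  have C: "subalgebra M C" using suff by (simp add: sufficient_for_def)
  interpret P: prob_space P by fact
  interpret Q: prob_space Q by fact
  interpret PC: finite_measure_subalgebra P C
    by (rule finite_measure_subalgebra_law[OF P C])
  interpret QC: finite_measure_subalgebra Q C
    by (rule finite_measure_subalgebra_law[OF Q C])
  let ?P = "restr_to_subalg P C" and ?Q = "restr_to_subalg Q C"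
  interpret rP: prob_space ?P
    by (rule prob_space_restr_to_subalg[OF PC.subalg P(1)])
  interpret rQ: prob_space ?Q
    by (rule prob_space_restr_to_subalg[OF QC.subalg Q(1)])
  have ac': "absolutely_continuous ?P ?Q"
    using ac unfolding absolutely_continuous_def
    by (auto simp: null_sets_restr_to_subalg PC.subalg QC.subalg)
  have sets_eq: "sets ?Q = sets ?P"
    by (simp add: sets_restr_to_subalg PC.subalg QC.subalg)
  obtain g where g: "g \<in> borel_measurable ?P" "AE x in ?P. RN_deriv ?P ?Q x = ennreal (g x)"
    and g_nonneg: "\<And>x. 0 \<le> g x"
    using rP.real_RN_deriv[OF rQ.finite_measure_axioms ac' sets_eq] by metis
  have gC[measurable]: "g \<in> borel_measurable C"
    by (rule measurable_in_subalg'[OF PC.subalg g(1)])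
  have gP[measurable]: "g \<in> borel_measurable P"
    by (rule measurable_from_subalg[OF PC.subalg gC])
  have dens: "?Q = density ?P (\<lambda>x. ennreal (g x))"
    using rP.density_RN_deriv[OF ac' sets_eq] density_cong[OF _ _ g(2)] g(1) by auto
  have change: "(\<integral>x. f x \<partial>Q) = (\<integral>x. g x * f x \<partial>P)" if f: "f \<in> borel_measurable C" for f :: "'a \<Rightarrow> real"
  proof -
    have "(\<integral>x. f x \<partial>Q) = (\<integral>x. f x \<partial>?Q)"
      by (rule integral_subalgebra2[OF QC.subalg f, symmetric])
    also have "\<dots> = (\<integral>x. g x * f x \<partial>?P)"
      unfolding dens using g(1) g_nonneg measurable_in_subalg[OF PC.subalg f]
      by (simp add: integral_density)
    also have "\<dots> = (\<integral>x. g x * f x \<partial>P)"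
      using gC f by (intro integral_subalgebra2[OF PC.subalg]) simp
    finally show ?thesis .
  qed
  have "(\<integral>\<^sup>+x. ennreal (g x) \<partial>P) = (\<integral>\<^sup>+x. ennreal (g x) \<partial>?P)"
    by (rule nn_integral_subalgebra2[OF PC.subalg, symmetric]) simp
  also have "\<dots> = emeasure (density ?P (\<lambda>x. ennreal (g x))) (space ?P)"
    using g(1) by (subst emeasure_density) (auto intro!: nn_integral_cong)
  also have "\<dots> = 1"
    unfolding dens[symmetric] using rQ.emeasure_space_1
    by (simp only: sets_eq_imp_space_eq[OF sets_eq])
  finally have "(\<integral>\<^sup>+x. ennreal (g x) \<partial>P) = 1" .
  then have g_int: "integrable P g"
    using g_nonneg by (intro integrableI_nonneg) auto
  have "Q = density P (\<lambda>x. ennreal (g x))"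
  proof (rule measure_eqI)
    show "sets Q = sets (density P (\<lambda>x. ennreal (g x)))" using P Q by simp
  next
    fix A assume A: "A \<in> sets Q"
    then have [measurable]: "A \<in> sets P" and AM: "A \<in> sets M" using P Q by auto
    obtain f where f[measurable]: "f \<in> borel_measurable C"
      and fP: "AE x in P. f x = real_cond_exp P C (indicator A) x"
      and fQ: "AE x in Q. f x = real_cond_exp Q C (indicator A) x"
      using suff AM unfolding sufficient_for_def by blast
    have gA: "integrable P (\<lambda>x. g x * indicator A x)"
      using integrable_real_mult_indicator[OF \<open>A \<in> sets P\<close> g_int] .
    have [measurable]: "f \<in> borel_measurable P" "f \<in> borel_measurable Q"
      using measurable_from_subalg[OF PC.subalg f] measurable_from_subalg[OF QC.subalg f] by auto
    have "measure Q A = (\<integral>x. indicator A x \<partial>Q)"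
      using A by simp
    also have "\<dots> = (\<integral>x. real_cond_exp Q C (indicator A) x \<partial>Q)"
      using A by (intro QC.real_cond_exp_int(2)[symmetric]) (simp add: Q.emeasure_eq_measure)
    also have "\<dots> = (\<integral>x. f x \<partial>Q)"
      using fQ by (intro integral_cong_AE) auto
    also have "\<dots> = (\<integral>x. g x * f x \<partial>P)" by (rule change[OF f])
    also have "\<dots> = (\<integral>x. g x * real_cond_exp P C (indicator A) x \<partial>P)"
      using fP by (intro integral_cong_AE) auto
    also have "\<dots> = (\<integral>x. g x * indicator A x \<partial>P)"
      using gA by (intro PC.real_cond_exp_intg(2)) auto
    finally have "emeasure Q A = ennreal (\<integral>x. g x * indicator A x \<partial>P)"
      by (simp add: Q.emeasure_eq_measure)
    also have "\<dots> = (\<integral>\<^sup>+x. ennreal (g x * indicator A x) \<partial>P)"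
      using gA g_nonneg by (intro nn_integral_eq_integral[symmetric]) auto
    also have "\<dots> = emeasure (density P (\<lambda>x. ennreal (g x))) A"
      by (auto simp: emeasure_density intro!: nn_integral_cong split: split_indicator)
    finally show "emeasure Q A = emeasure (density P (\<lambda>x. ennreal (g x))) A" .
  qed
  then show ?thesis using gC g_nonneg unfolding density_over_def by blast
qed

text \<open>A factor measurable with respect to \<open>C\<close> can be pulled out of a conditional expectation given
  \<open>C\<close>, so reweighting by it does not change the conditional expectation.\<close>

lemma real_cond_exp_density_over:
  assumes P: "finite_measure_subalgebra P C" and Q: "finite_measure_subalgebra Q C"
    and dens: "density_over C P Q" and h: "integrable Q h"
  shows "AE x in Q. real_cond_exp Q C h x = real_cond_exp P C h x"
proof -
  interpret P: finite_measure_subalgebra P C by fact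
  interpret Q: finite_measure_subalgebra Q C by fact
  obtain g where g[measurable]: "g \<in> borel_measurable C" and g_nonneg: "\<And>x. 0 \<le> (g x :: real)"
    and Q_eq: "Q = density P (\<lambda>x. ennreal (g x))"
    using dens by (auto simp: density_over_def)
  have gP[measurable]: "g \<in> borel_measurable P"
    by (rule measurable_from_subalg[OF P.subalg g])
  have hP[measurable]: "h \<in> borel_measurable P"
    using borel_measurable_integrable[OF h] by (simp add: Q_eq)
  have gh: "integrable P (\<lambda>x. g x * h x)"
    using h g_nonneg unfolding Q_eq by (simp add: integrable_density)
  show ?thesis
  proof (rule Q.real_cond_exp_charact[OF _ h])
    show "integrable Q (real_cond_exp P C h)"
      using P.real_cond_exp_intg(1)[OF gh] g_nonneg unfolding Q_eq by (simp add: integrable_density)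
    fix A assume A[measurable]: "A \<in> sets C"
    have AP[measurable]: "A \<in> sets P" using A P.subalg by (auto simp: subalgebra_def)
    have gAh: "integrable P (\<lambda>x. (g x * indicator A x) * h x)"
      using integrable_real_mult_indicator[OF AP gh] by (simp add: ac_simps)
    have "(\<integral>x\<in>A. h x \<partial>Q) = (\<integral>x. (g x * indicator A x) * h x \<partial>P)"
      unfolding Q_eq set_lebesgue_integral_def using g_nonneg
      by (simp add: integral_density ac_simps)
    also have "\<dots> = (\<integral>x. (g x * indicator A x) * real_cond_exp P C h x \<partial>P)"
      by (rule P.real_cond_exp_intg(2)[OF gAh, symmetric]) auto
    also have "\<dots> = (\<integral>x\<in>A. real_cond_exp P C h x \<partial>Q)"
      unfolding Q_eq set_lebesgue_integral_def using g_nonneg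
      by (simp add: integral_density ac_simps)
    finally show "(\<integral>x\<in>A. h x \<partial>Q) = (\<integral>x\<in>A. real_cond_exp P C h x \<partial>Q)" .
  qed simp
qed

text \<open>Conditional probabilities computed under one fixed law of the model serve all the others.\<close>

lemma sufficient_if_density_over:
  assumes \<P>: "model M \<P>" and C: "subalgebra M C"
    and dens: "\<And>P Q. P \<in> \<P> \<Longrightarrow> Q \<in> \<P> \<Longrightarrow> density_over C P Q"
  shows "sufficient_for M \<P> C"
  unfolding sufficient_for_def
proof (intro conjI ballI C)
  fix A assume A: "A \<in> sets M"
  show "\<exists>f\<in>borel_measurable C. \<forall>P\<in>\<P>. AE x in P. f x = real_cond_exp P C (indicator A) x"
  proof (cases "\<P> = {}")
    case False
    then obtain P0 where P0: "P0 \<in> \<P>" by auto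
    have law: "finite_measure_subalgebra P C" if "P \<in> \<P>" for P
      using modelD[OF \<P> that] C by (intro finite_measure_subalgebra_law) auto
    have "AE x in P. real_cond_exp P0 C (indicator A) x = real_cond_exp P C (indicator A) x"
      if P: "P \<in> \<P>" for P
    proof -
      interpret prob_space P using modelD[OF \<P> P] by simp
      have "integrable P (indicator A :: 'a \<Rightarrow> real)"
        using A modelD[OF \<P> P] by (simp add: emeasure_eq_measure)
      from real_cond_exp_density_over[OF law[OF P0] law[OF P] dens[OF P0 P] this]
      show ?thesis by auto
    qed
    then show ?thesis
      by (intro bexI[of _ "real_cond_exp P0 C (indicator A)"]) auto
  qed (auto intro!: exI[of _ "\<lambda>_. 0"])
qed

lemma density_over_if_sufficient:
  assumes "model M \<P>" "homogeneous \<P>" "sufficient_for M \<P> C" "P \<in> \<P>" "Q \<in> \<P>"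
  shows "density_over C P Q"
  using modelD[OF assms(1)] assms
  by (intro sufficient_imp_density_over[where M = M])
     (auto simp: homogeneous_def intro: sufficient_for_subset)

section \<open>Chains of submodels\<close>

lemma density_over_chain:
  fixes n :: nat
  assumes sub: "\<And>k. k \<in> {1..n} \<Longrightarrow> subalgebra (R k) D"
    and step: "\<And>k. k \<in> {1..n-1} \<Longrightarrow> density_over D (R k) (R (k + 1))"
    and "n \<ge> 1"
  shows "density_over D (R 1) (R n)"
proof -
  have "density_over D (R 1) (R k)" if "1 \<le> k" "k \<le> n" for k
    using that
  proof (induction k rule: dec_induct)
    case base
    show ?case by (rule density_over_refl)
  next
    case (step m)
    then have "density_over D (R 1) (R m)" "density_over D (R m) (R (m + 1))"
      using assms(2)[of m] by auto
    then show ?case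
      using density_over_trans[OF sub[of 1]] \<open>n \<ge> 1\<close> by simp
  qed
  then show ?thesis using \<open>n \<ge> 1\<close> by simp
qed

text \<open>Consecutive members of a chain lie in a common submodel for which some \<open>C i\<close> is sufficient; so
  their density is measurable with respect to that \<open>C i\<close>, which may change from link to link. Only the
  join sees all the factors of the density between the ends.\<close>

lemma sufficient_subalg_join:
  fixes \<Q> :: "'i \<Rightarrow> 'h \<Rightarrow> 'a measure set"
  assumes \<P>: "model M \<P>" "homogeneous \<P>"
    and C: "\<And>i. i \<in> I \<Longrightarrow> subalgebra M (C i)"
    and ex: "\<And>i. i \<in> I \<Longrightarrow> exhaustion \<P> (H i) (\<Q> i)"
    and chain: "\<And>P' P''. P' \<in> \<P> \<Longrightarrow> P'' \<in> \<P> \<Longrightarrow>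
           \<exists>(n::nat) R. n \<ge> 1 \<and> (\<forall>k\<in>{1..n}. R k \<in> \<P>) \<and> R 1 = P' \<and> R n = P'' \<and>
             (\<forall>k\<in>{1..n-1}. \<exists>i\<in>I. \<exists>\<eta>\<in>H i. R k \<in> \<Q> i \<eta> \<and> R (k + 1) \<in> \<Q> i \<eta>)"
    and suff: "\<And>i \<eta>. i \<in> I \<Longrightarrow> \<eta> \<in> H i \<Longrightarrow> sufficient_for M (\<Q> i \<eta>) (C i)"
  shows "sufficient_for M \<P> (subalg_join M I C)"
proof (rule sufficient_if_density_over[OF \<P>(1) subalgebra_subalg_join[OF C]])
  let ?D = "subalg_join M I C"
  fix P Q assume "P \<in> \<P>" "Q \<in> \<P>"
  from chain[OF this] obtain n :: nat and R
    where R: "n \<ge> 1" "\<forall>k\<in>{1..n}. R k \<in> \<P>" "R 1 = P" "R n = Q"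
      and step: "\<forall>k\<in>{1..n-1}. \<exists>i\<in>I. \<exists>\<eta>\<in>H i. R k \<in> \<Q> i \<eta> \<and> R (k + 1) \<in> \<Q> i \<eta>"
    by (elim exE conjE) (rule that)
  have "density_over ?D (R 1) (R n)"
  proof (rule density_over_chain[OF _ _ R(1)])
    show "subalgebra (R k) ?D" if "k \<in> {1..n}" for k
      using subalgebra_subalg_join[of I M C, OF C] modelD[OF \<P>(1) bspec[OF R(2) that]]
      by (auto simp: subalgebra_def)
    show "density_over ?D (R k) (R (k + 1))" if k: "k \<in> {1..n-1}" for k
    proof -
      from bspec[OF step k] obtain i \<eta> where i: "i \<in> I" "\<eta> \<in> H i" and R_mem: "R k \<in> \<Q> i \<eta>" "R (k + 1) \<in> \<Q> i \<eta>"
        by (elim bexE conjE)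
      have "\<Q> i \<eta> \<subseteq> \<P>" using ex i by (auto simp: exhaustion_def)
      then have "density_over (C i) (R k) (R (k + 1))"
        by (intro density_over_if_sufficient[OF _ _ suff[OF i] R_mem]
              model_subset[OF \<P>(1)] homogeneous_subset[OF \<P>(2)])
      then show ?thesis
        by (rule density_over_mono[rotated]) (rule subalgebra_in_subalg_join[OF C i(1)])
    qed
  qed
  then show "density_over ?D P Q" using R by simp
qed

section \<open>Minimality of the join\<close>

text \<open>In a homogeneous model a single law determines the null sets of all others, so containment up
  to null sets extends from any nonempty submodel to the whole model.\<close>

lemma subalg_mod_homogeneous:
  assumes \<P>: "model M \<P>" "homogeneous \<P>" and "\<Q> \<subseteq> \<P>" "\<Q> \<noteq> {}"
    and C: "subalgebra M C" and D: "subalgebra M D" and mod: "subalg_mod \<Q> C D"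
  shows "subalg_mod \<P> C D"
  unfolding subalg_mod_def
proof
  fix A assume A: "A \<in> sets C"
  obtain B where B: "B \<in> sets D" "\<forall>P\<in>\<Q>. emeasure P (sym_diff A B) = 0"
    using mod A by (auto simp: subalg_mod_def)
  obtain P0 where P0: "P0 \<in> \<Q>" "P0 \<in> \<P>" using assms by auto
  have "sym_diff A B \<in> sets P0"
    unfolding modelD(2)[OF \<P>(1) P0(2)]
    using A B(1) C D by (intro sets.Un sets.Diff) (auto simp: subalgebra_def)
  then have "\<forall>P\<in>\<P>. emeasure P (sym_diff A B) = 0"
    using \<P>(2) P0 B(2) absolutely_continuousD unfolding homogeneous_def by blast
  then show "\<exists>B\<in>sets D. \<forall>P\<in>\<P>. emeasure P (sym_diff A B) = 0" using B(1) by blast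
qed

text \<open>The sets with a \<open>D\<close>-measurable approximation up to common null sets form a \<open>\<sigma>\<close>-algebra.
  Measurability of these sets is carried through the induction because exceptional sets must be
  measurable to be null.\<close>

lemma subalg_mod_join:
  assumes \<P>: "model M \<P>"
    and C: "\<And>i. i \<in> I \<Longrightarrow> subalgebra M (C i)" and D: "subalgebra M D"
    and mod: "\<And>i. i \<in> I \<Longrightarrow> subalg_mod \<P> (C i) D"
  shows "subalg_mod \<P> (subalg_join M I C) D"
proof -
  have "A \<in> sets M \<and> (\<exists>B\<in>sets D. \<forall>P\<in>\<P>. emeasure P (sym_diff A B) = 0)"
    if "A \<in> sigma_sets (space M) (\<Union>i\<in>I. sets (C i))" for A
    using that
  proof induction
    case (Basic A)
    then show ?case using C mod by (auto simp: subalgebra_def subalg_mod_def)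
  next
    case Empty
    then show ?case by (auto intro!: bexI[of _ "{}"])
  next
    case (Compl A)
    then obtain B where A: "A \<in> sets M" and B: "B \<in> sets D" "\<forall>P\<in>\<P>. emeasure P (sym_diff A B) = 0"
      by auto
    have "B \<subseteq> space M" "A \<subseteq> space M"
      using B(1) D A sets.sets_into_space by (force simp: subalgebra_def)+
    then have "sym_diff (space M - A) (space M - B) = sym_diff A B" by auto
    moreover have "space M - B \<in> sets D" 
      using sets.compl_sets[OF B(1)] D by (simp add: subalgebra_def)
    ultimately show ?case using A B(2) by (metis sets.compl_sets)
  next
    case (Union A)
    then have A: "\<And>n. A n \<in> sets M" by auto
    have "\<forall>n::nat. \<exists>B\<in>sets D. \<forall>P\<in>\<P>. emeasure P (sym_diff (A n) B) = 0"
      using Union.IH by blast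
    then obtain B where B: "\<And>n. B n \<in> sets D" "\<And>n P. P \<in> \<P> \<Longrightarrow> emeasure P (sym_diff (A n) (B n)) = 0"
      by metis
    have BM: "B n \<in> sets M" for n using B(1) D by (auto simp: subalgebra_def)
    have "emeasure P (sym_diff (\<Union>n. A n) (\<Union>n. B n)) = 0" if P: "P \<in> \<P>" for P
    proof -
      have "(\<Union>n. sym_diff (A n) (B n)) \<in> null_sets P"
        using A BM B(2)[OF P] modelD(2)[OF \<P> P] by (intro null_sets_UN) auto
      moreover have "sym_diff (\<Union>n. A n) (\<Union>n. B n) \<subseteq> (\<Union>n. sym_diff (A n) (B n))" by blast
      moreover have "sym_diff (\<Union>n. A n) (\<Union>n. B n) \<in> sets P"
        using A BM modelD(2)[OF \<P> P] by auto
      ultimately show ?thesis using null_sets_subset by blast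
    qed
    then show ?case using A B(1) by (auto intro!: bexI[of _ "\<Union>n. B n"])
  qed
  then show ?thesis
    unfolding subalg_mod_def using sets_subalg_join[of I M C, OF C] by auto
qed

lemma minimal_subalg_join:
  assumes \<P>: "model M \<P>" "homogeneous \<P>"
    and C: "\<And>i. i \<in> I \<Longrightarrow> subalgebra M (C i)"
    and ex: "\<And>i. i \<in> I \<Longrightarrow> exhaustion \<P> (H i) (\<Q> i)"
    and min: "\<And>i \<eta>. i \<in> I \<Longrightarrow> \<eta> \<in> H i \<Longrightarrow> minimal_sufficient_for M (\<Q> i \<eta>) (C i)"
    and D: "sufficient_for M \<P> D"
  shows "subalg_mod \<P> (subalg_join M I C) D"
proof (rule subalg_mod_join[OF \<P>(1) C])
  show DM: "subalgebra M D" using D by (simp add: sufficient_for_def)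
  show "subalg_mod \<P> (C i) D" if i: "i \<in> I" for i
  proof (cases "\<P> = {}")
    case True
    then show ?thesis by (auto simp: subalg_mod_def)
  next
    case False
    then obtain P where "P \<in> \<P>" by auto
    then obtain \<eta> where \<eta>: "\<eta> \<in> H i" "P \<in> \<Q> i \<eta>" "\<Q> i \<eta> \<subseteq> \<P>"
      using exhaustion_member[OF ex[OF i]] by metis
    have "subalg_mod (\<Q> i \<eta>) (C i) D"
      using min[OF i \<eta>(1)] sufficient_for_subset[OF D \<eta>(3)]
      by (simp add: minimal_sufficient_for_def)
    then show ?thesis
      using \<eta> by (intro subalg_mod_homogeneous[OF \<P> \<eta>(3) _ C[OF i] DM]) auto
  qed
qed

section \<open>Completeness of the join\<close>

definition unbiased_zero :: "'a measure set \<Rightarrow> ('a \<Rightarrow> real) \<Rightarrow> bool" where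
  "unbiased_zero \<P> h \<longleftrightarrow> (\<forall>P\<in>\<P>. integrable P h \<and> (\<integral>x. h x \<partial>P) = 0)"

lemma unbiased_zero_diff:
  "unbiased_zero \<P> h \<Longrightarrow> unbiased_zero \<P> k \<Longrightarrow> unbiased_zero \<P> (\<lambda>x. h x - k x)"
  by (auto simp: unbiased_zero_def)

text \<open>By sufficiency a single \<open>C\<close>-measurable function is the conditional expectation of \<open>h\<close> under all
  laws of the submodel. It has the same integrals as \<open>h\<close>, so completeness annihilates it, and the
  integral of \<open>h\<close> over a member of \<open>C\<close> is the integral of a null function.\<close>

lemma unbiased_zero_restrict_complete:
  assumes \<P>: "model M \<P>" "homogeneous \<P>"
    and suff: "sufficient_for M \<P> C" and compl: "complete_for M \<P> C"
    and h: "unbiased_zero \<P> h" and A: "A \<in> sets C"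
  shows "unbiased_zero \<P> (\<lambda>x. h x * indicator A x)"
proof (cases "\<P> = {}")
  case True
  then show ?thesis by (simp add: unbiased_zero_def)
next
  case False
  then obtain P0 where P0: "P0 \<in> \<P>" by auto
  have C: "subalgebra M C" using suff by (simp add: sufficient_for_def)
  have law: "finite_measure_subalgebra P C" if "P \<in> \<P>" for P
    using modelD[OF \<P>(1) that] C by (intro finite_measure_subalgebra_law) auto
  define f where "f = real_cond_exp P0 C h"
  have f_meas: "f \<in> borel_measurable C" by (simp add: f_def)
  have f_version: "AE x in P. real_cond_exp P C h x = f x" if P: "P \<in> \<P>" for P
    unfolding f_def using h P
    by (intro real_cond_exp_density_over[OF law[OF P0] law[OF P]]
          density_over_if_sufficient[OF \<P> suff P0 P]) (simp add: unbiased_zero_def)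
  have "integrable P f \<and> (\<integral>x. f x \<partial>P) = 0" if P: "P \<in> \<P>" for P
  proof -
    interpret finite_measure_subalgebra P C by (rule law[OF P])
    have hP: "integrable P h" "(\<integral>x. h x \<partial>P) = 0" using h P by (auto simp: unbiased_zero_def)
    have fP: "f \<in> borel_measurable P" by (rule measurable_from_subalg[OF subalg f_meas])
    have "integrable P f"
      by (rule integrable_cong_AE_imp[OF real_cond_exp_int(1)[OF hP(1)] fP f_version[OF P]])
    moreover have "(\<integral>x. f x \<partial>P) = (\<integral>x. real_cond_exp P C h x \<partial>P)"
      using f_version[OF P] fP by (intro integral_cong_AE) auto
    ultimately show ?thesis using real_cond_exp_int(2)[OF hP(1)] hP(2) by simp
  qed
  then have f_zero: "AE x in P. f x = 0" if "P \<in> \<P>" for P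
    using compl f_meas that unfolding complete_for_def by blast
  show ?thesis
    unfolding unbiased_zero_def
  proof
    fix P assume P: "P \<in> \<P>"
    interpret finite_measure_subalgebra P C by (rule law[OF P])
    have hP: "integrable P h" using h P by (auto simp: unbiased_zero_def)
    have AP: "A \<in> sets P" using A subalg by (auto simp: subalgebra_def)
    have "(\<integral>x. h x * indicator A x \<partial>P) = (\<integral>x\<in>A. h x \<partial>P)"
      by (simp add: set_lebesgue_integral_def mult.commute)
    also have "\<dots> = (\<integral>x\<in>A. real_cond_exp P C h x \<partial>P)" by (rule real_cond_exp_intA[OF hP A])
    also have "\<dots> = 0"
      unfolding set_lebesgue_integral_def
      using f_version[OF P] f_zero[OF P] by (intro integral_eq_zero_AE) auto
    finally show "integrable P (\<lambda>x. h x * indicator A x) \<and> (\<integral>x. h x * indicator A x \<partial>P) = 0"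
      using integrable_real_mult_indicator[OF AP hP] by simp
  qed
qed

text \<open>The lemma is applied to the union of several \<open>\<sigma>\<close>-algebras, which is not closed under
  intersections, so the usual monotone class argument for a fixed \<open>h\<close> would not start. Quantifying
  over all unbiased estimators of zero repairs this: restricting to one set and then to another is
  restricting to the intersection, so the admissible sets form an algebra, and dominated convergence
  gives countable unions.\<close>

lemma unbiased_zero_restrict_sigma:
  assumes \<P>: "model M \<P>" and G: "G \<subseteq> sets M"
    and base: "\<And>A h. A \<in> G \<Longrightarrow> unbiased_zero \<P> h \<Longrightarrow> unbiased_zero \<P> (\<lambda>x. h x * indicator A x)"
    and "A \<in> sigma_sets (space M) G" "unbiased_zero \<P> h"
  shows "unbiased_zero \<P> (\<lambda>x. h x * indicator A x)"
  using assms(4,5)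
proof (induction arbitrary: h)
  case (Basic A)
  then show ?case by (rule base)
next
  case Empty
  show ?case by (simp add: unbiased_zero_def)
next
  case (Compl A)
  have "unbiased_zero \<P> (\<lambda>x. h x - h x * indicator A x)"
    by (intro unbiased_zero_diff Compl)
  moreover have "integrable P (\<lambda>x. h x - h x * indicator A x) = integrable P (\<lambda>x. h x * indicator (space M - A) x)"
    "(\<integral>x. h x - h x * indicator A x \<partial>P) = (\<integral>x. h x * indicator (space M - A) x \<partial>P)"
    if "P \<in> \<P>" for P
    using modelD(3)[OF \<P> that]
    by (auto intro!: Bochner_Integration.integrable_cong Bochner_Integration.integral_cong
        split: split_indicator)
  ultimately show ?case by (simp add: unbiased_zero_def)
next
  case (Union A)
  have A: "A n \<in> sets M" for n
    using Union.hyps[of n] sets.sigma_sets_subset[OF G] by blast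
  have partial: "unbiased_zero \<P> (\<lambda>x. h x * indicator (\<Union>k<n. A k) x)" for n
  proof (induction n)
    case 0
    show ?case by (simp add: unbiased_zero_def)
  next
    case (Suc n)
    \<comment> \<open>The complement of a union is an intersection of complements: restrict to the complement of
       the first \<open>n\<close> sets, then to that of \<open>A n\<close>, and subtract the result from \<open>h\<close>.\<close>
    define k where "k = (\<lambda>x. h x - h x * indicator (\<Union>k<n. A k) x)"
    have k: "unbiased_zero \<P> k"
      unfolding k_def by (intro unbiased_zero_diff Union.prems Suc)
    have "unbiased_zero \<P> (\<lambda>x. h x - (k x - k x * indicator (A n) x))"
      by (intro unbiased_zero_diff Union.prems k Union.IH)
    also have "(\<lambda>x. h x - (k x - k x * indicator (A n) x)) = (\<lambda>x. h x * indicator (\<Union>k<Suc n. A k) x)"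
      by (auto simp: k_def lessThan_Suc fun_eq_iff split: split_indicator)
    finally show ?case .
  qed
  show ?case
    unfolding unbiased_zero_def
  proof
    fix P assume P: "P \<in> \<P>"
    have hP: "integrable P h" using Union.prems P by (auto simp: unbiased_zero_def)
    have AP: "A n \<in> sets P" for n using A modelD(2)[OF \<P> P] by simp
    have "(\<lambda>n. \<integral>x. h x * indicator (\<Union>k<n. A k) x \<partial>P) \<longlonglongrightarrow> (\<integral>x. h x * indicator (\<Union>k. A k) x \<partial>P)"
    proof (rule integral_dominated_convergence[where w = "\<lambda>x. \<bar>h x\<bar>"])
      show "(\<lambda>x. h x * indicator (\<Union>k. A k) x) \<in> borel_measurable P"
        using AP hP by measurable
      show "(\<lambda>x. h x * indicator (\<Union>k<n. A k) x) \<in> borel_measurable P" for n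
        using AP hP by measurable
      show "integrable P (\<lambda>x. \<bar>h x\<bar>)" using hP by simp
      show "AE x in P. (\<lambda>n. h x * indicator (\<Union>k<n. A k) x) \<longlonglongrightarrow> h x * indicator (\<Union>k. A k) x"
        by (intro AE_I2 tendsto_mult tendsto_const LIMSEQ_indicator_UN)
      show "AE x in P. norm (h x * indicator (\<Union>k<n. A k) x) \<le> \<bar>h x\<bar>" for n
        by (auto split: split_indicator)
    qed
    moreover have "(\<integral>x. h x * indicator (\<Union>k<n. A k) x \<partial>P) = 0" for n
      using partial P by (auto simp: unbiased_zero_def)
    ultimately have "(\<integral>x. h x * indicator (\<Union>k. A k) x \<partial>P) = 0"
      by (simp add: LIMSEQ_const_iff)
    then show "integrable P (\<lambda>x. h x * indicator (\<Union>k. A k) x) \<and> (\<integral>x. h x * indicator (\<Union>k. A k) x \<partial>P) = 0"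
      using integrable_real_mult_indicator[OF _ hP] AP by auto
  qed
qed

lemma complete_subalg_join:
  assumes \<P>: "model M \<P>" "homogeneous \<P>"
    and C: "\<And>i. i \<in> I \<Longrightarrow> subalgebra M (C i)"
    and ex: "\<And>i. i \<in> I \<Longrightarrow> exhaustion \<P> (H i) (\<Q> i)"
    and compl: "\<And>i \<eta>. i \<in> I \<Longrightarrow> \<eta> \<in> H i \<Longrightarrow> complete_for M (\<Q> i \<eta>) (C i)"
    and suff: "\<And>i \<eta>. i \<in> I \<Longrightarrow> \<eta> \<in> H i \<Longrightarrow> sufficient_for M (\<Q> i \<eta>) (C i)"
  shows "complete_for M \<P> (subalg_join M I C)"
  unfolding complete_for_def
proof (intro conjI allI impI ballI)
  let ?D = "subalg_join M I C"
  show D: "subalgebra M ?D" by (rule subalgebra_subalg_join[OF C])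
  fix h :: "'a \<Rightarrow> real" and P
  assume h: "h \<in> borel_measurable ?D" and P: "P \<in> \<P>"
    and zero: "\<forall>P\<in>\<P>. integrable P h \<and> (\<integral>x. h x \<partial>P) = 0"
  have base: "unbiased_zero \<P> (\<lambda>x. k x * indicator A x)"
    if A: "A \<in> (\<Union>i\<in>I. sets (C i))" and k: "unbiased_zero \<P> k" for A k
  proof -
    obtain i where i: "i \<in> I" "A \<in> sets (C i)" using A by auto
    have "integrable R (\<lambda>x. k x * indicator A x) \<and> (\<integral>x. k x * indicator A x \<partial>R) = 0"
      if R: "R \<in> \<P>" for R
    proof -
      obtain \<eta> where \<eta>: "\<eta> \<in> H i" "R \<in> \<Q> i \<eta>" "\<Q> i \<eta> \<subseteq> \<P>"
        using exhaustion_member[OF ex[OF i(1)] R] by metis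
      have "unbiased_zero (\<Q> i \<eta>) k" using k \<eta>(3) by (auto simp: unbiased_zero_def)
      then have "unbiased_zero (\<Q> i \<eta>) (\<lambda>x. k x * indicator A x)"
        using unbiased_zero_restrict_complete[OF model_subset[OF \<P>(1) \<eta>(3)]
            homogeneous_subset[OF \<P>(2) \<eta>(3)] suff[OF i(1) \<eta>(1)] compl[OF i(1) \<eta>(1)] _ i(2)]
        by blast
      then show ?thesis using \<eta>(2) by (simp add: unbiased_zero_def)
    qed
    then show ?thesis by (simp add: unbiased_zero_def)
  qed
  have gen: "(\<Union>i\<in>I. sets (C i)) \<subseteq> sets M" using C by (auto simp: subalgebra_def)
  interpret finite_measure_subalgebra P ?D
    using modelD[OF \<P>(1) P] D by (intro finite_measure_subalgebra_law) auto
  have hP: "integrable P h" using zero P by blast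
  have "(\<integral>x\<in>A. h x \<partial>P) = (\<integral>x\<in>A. 0 \<partial>P)" if "A \<in> sets ?D" for A
  proof -
    have "unbiased_zero \<P> (\<lambda>x. h x * indicator A x)"
      using that zero sets_subalg_join[of I M C, OF C]
      by (intro unbiased_zero_restrict_sigma[OF \<P>(1) gen base]) (auto simp: unbiased_zero_def)
    then show ?thesis
      using P by (simp add: unbiased_zero_def set_lebesgue_integral_def mult.commute)
  qed
  \<comment> \<open>The conditional expectation of \<open>h\<close> given the join is both \<open>h\<close> and zero.\<close>
  then have "AE x in P. real_cond_exp P ?D h x = 0"
    using hP by (intro real_cond_exp_charact) auto
  moreover have "AE x in P. real_cond_exp P ?D h x = h x"
    using hP h by (intro real_cond_exp_F_meas)
  ultimately show "AE x in P. h x = 0" by auto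
qed


theorem theorem1p5:
  fixes M :: "'a measure"
    and \<P> :: "'a measure set"
    and I :: "'i set"
    and C :: "'i \<Rightarrow> 'a measure"
    and H :: "'i \<Rightarrow> 'h set"
    and \<Q> :: "'i \<Rightarrow> 'h \<Rightarrow> 'a measure set"
  assumes "model M \<P>"
    and "homogeneous \<P>"
    and "\<And>i. i \<in> I \<Longrightarrow> subalgebra M (C i)"
    and "\<And>i. i \<in> I \<Longrightarrow> exhaustion \<P> (H i) (\<Q> i)"
    and "\<And>P' P''. P' \<in> \<P> \<Longrightarrow> P'' \<in> \<P> \<Longrightarrow>
           \<exists>(n::nat) R. n \<ge> 1 \<and> (\<forall>k\<in>{1..n}. R k \<in> \<P>) \<and> R 1 = P' \<and> R n = P'' \<and>
             (\<forall>k\<in>{1..n-1}. \<exists>i\<in>I. \<exists>\<eta>\<in>H i. R k \<in> \<Q> i \<eta> \<and> R (k + 1) \<in> \<Q> i \<eta>)"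
  shows "((\<forall>i\<in>I. \<forall>\<eta>\<in>H i. sufficient_for M (\<Q> i \<eta>) (C i)) \<longrightarrow>
            sufficient_for M \<P> (subalg_join M I C)) \<and>
         ((\<forall>i\<in>I. \<forall>\<eta>\<in>H i. minimal_sufficient_for M (\<Q> i \<eta>) (C i)) \<longrightarrow>
            minimal_sufficient_for M \<P> (subalg_join M I C)) \<and>
         ((\<forall>i\<in>I. \<forall>\<eta>\<in>H i. complete_for M (\<Q> i \<eta>) (C i) \<and> sufficient_for M (\<Q> i \<eta>) (C i)) \<longrightarrow>
            complete_for M \<P> (subalg_join M I C) \<and> sufficient_for M \<P> (subalg_join M I C))"
proof (intro conjI impI)
  note join_sufficient = sufficient_subalg_join[where H = H and \<Q> = \<Q>, OF assms]
  {
    assume "\<forall>i\<in>I. \<forall>\<eta>\<in>H i. sufficient_for M (\<Q> i \<eta>) (C i)"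
    then show "sufficient_for M \<P> (subalg_join M I C)"
      by (intro join_sufficient) auto
  next
    assume min: "\<forall>i\<in>I. \<forall>\<eta>\<in>H i. minimal_sufficient_for M (\<Q> i \<eta>) (C i)"
    have "sufficient_for M \<P> (subalg_join M I C)"
      using min by (intro join_sufficient) (auto simp: minimal_sufficient_for_def)
    moreover have "subalg_mod \<P> (subalg_join M I C) D" if "sufficient_for M \<P> D" for D
      by (rule minimal_subalg_join[where H = H and \<Q> = \<Q>, OF assms(1-4) _ that])
         (use min in auto)
    ultimately show "minimal_sufficient_for M \<P> (subalg_join M I C)"
      by (simp add: minimal_sufficient_for_def)
  next
    assume cs: "\<forall>i\<in>I. \<forall>\<eta>\<in>H i. complete_for M (\<Q> i \<eta>) (C i) \<and> sufficient_for M (\<Q> i \<eta>) (C i)"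
    show "complete_for M \<P> (subalg_join M I C)"
      by (rule complete_subalg_join[where H = H and \<Q> = \<Q>, OF assms(1-4)])
         (use cs in auto)
    show "sufficient_for M \<P> (subalg_join M I C)"
      using cs by (intro join_sufficient) auto
  }
qed

end
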